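(* Let $n$ be a nonnegative integer and $\nu>1$ an integer. For every composition $\gamma$ of $n$, $$\blacktriangle(\kappa_{\mathrm{set}(\gamma)}(\nu))=\sum_{\alpha\odot\beta=\gamma}\kappa_{\mathrm{set}(\alpha)}(\nu)\otimes\kappa_{\mathrm{set}(\beta)}(\nu),$$ where the sum is over all pairs $(\alpha,\beta)$ of (possibly empty) compositions with $\alpha\odot\beta=\gamma$.
   Context: Notation: $[k]=\{1,\dots,k\}$ for $k\ge1$ and $[k]=\emptyset$ for $k\le 0$. For a composition $\alpha=(\alpha_1,\dots,\alpha_l)$ of $n$, $\mathrm{set}(\alpha)=\{\alpha_1,\alpha_1+\alpha_2,\dots,\alpha_1+\dots+\alpha_{l-1}\}\subseteq[n-1]$; $\mathrm{set}$ of the empty composition is empty. For nonempty compositions, the near-concatenation is $(\alpha_1,\dots,\alpha_l)\odot(\beta_1,\dots,\beta_k)=(\alpha_1,\dots,\alpha_{l-1},\alpha_l+\beta_1,\beta_2,\dots,\beta_k)$; also $\alpha\odot\emptyset=\alpha$ and $\emptyset\odot\beta=\beta$. Let $C_\nu$ be a cyclic group of order $\nu$, written additively. For $n\ge0$ let $Q_n(\nu)=\bigoplus_{i\in[n-1]}C_\nu$ (trivial if $n\le1$), with elements $g=(g_i)_{i\in[n-1]}$; $\mathrm{cf}(Q_n(\nu))$ is the space of complex (class) functions on $Q_n(\nu)$; $\mathrm{cf}(Q_0(\nu))=\mathbb C\mathbb 1_0$. For a composition $\alpha$ of $n$, $\kappa_{\mathrm{set}(\alpha)}(\nu)\in\mathrm{cf}(Q_n(\nu))$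 is the indicator function of $\{g\in Q_n(\nu): g_i\ne0\iff i\in\mathrm{set}(\alpha)\}$ (for $\alpha=\emptyset$ it is $\mathbb 1_0$). Coproduct. For $\phi\in\mathrm{cf}(Q_n(\nu))$: $\blacktriangle_0(\phi)=\mathbb 1_0\otimes\phi$, $\blacktriangle_n(\phi)=\phi\otimes\mathbb 1_0$, and for $1\le k\le n-1$, $\blacktriangle_k(\phi)\in\mathrm{cf}(Q_k(\nu))\otimes\mathrm{cf}(Q_{n-k}(\nu))$ is the element corresponding to the function $(x,y)\mapsto\phi(x_1,\dots,x_{k-1},0,y_1,\dots,y_{n-k-1})$ on $Q_k(\nu)\times Q_{n-k}(\nu)$. Then $\blacktriangle=\sum_{k=0}^n\blacktriangle_k$. *)

theory Defs
  imports
    Complex_Main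
    "HOL-Algebra.Elementary_Groups"
    "HOL-Algebra.Product_Groups"
    "HOL-Library.Function_Algebras"
    "HOL-Library.Indicator_Function"
    "HOL-Library.Poly_Mapping"
begin

definition compositions :: "nat list set" where
  "compositions = {\<alpha>. \<forall>a\<in>set \<alpha>. 0 < a}"

definition compositions_of :: "nat \<Rightarrow> nat list set" where
  "compositions_of n = {\<alpha> \<in> compositions. sum_list \<alpha> = n}"

definition comp_set :: "nat list \<Rightarrow> nat set" where
  "comp_set \<alpha> = {sum_list (take j \<alpha>) | j. 1 \<le> j \<and> j < length \<alpha>}"

fun near_concat :: "nat list \<Rightarrow> nat list \<Rightarrow> nat list" (infixr "\<odot>" 65) where
  "[] \<odot> \<beta> = \<beta>"
| "\<alpha> \<odot> [] = \<alpha>"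
| "(a # \<alpha>) \<odot> (b # \<beta>) =
     butlast (a # \<alpha>) @ [last (a # \<alpha>) + b] @ \<beta>"

definition near_splittings :: "nat list \<Rightarrow> (nat list \<times> nat list) set" where
  "near_splittings \<gamma> = {(\<alpha>, \<beta>). \<alpha> \<in> compositions \<and> \<beta> \<in> compositions \<and> \<alpha> \<odot> \<beta> = \<gamma>}"

lemma sum_list_near_concat: "sum_list (\<alpha> \<odot> \<beta>) = sum_list \<alpha> + sum_list \<beta>"
proof (induction \<alpha> \<beta> rule: near_concat.induct)
  case (3 a \<alpha> b \<beta>)
  have "sum_list (a # \<alpha>) = sum_list (butlast (a # \<alpha>) @ [last (a # \<alpha>)])"
    by (metis append_butlast_last_id list.distinct(1))
  then have "sum_list (a # \<alpha>) = sum_list (butlast (a # \<alpha>)) + last (a # \<alpha>)"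
    by (simp only: sum_list_append sum_list.Cons sum_list.Nil)
  then show ?case
    by (simp only: near_concat.simps sum_list_append sum_list.Cons[of _ \<beta>] sum_list.Cons sum_list.Nil)
qed simp_all

lemma length_le_sum_list: "\<alpha> \<in> compositions \<Longrightarrow> length \<alpha> \<le> sum_list \<alpha>"
  by (induction \<alpha>) (auto simp: compositions_def)

text \<open>A sum over an infinite set is 0 by convention; the following excludes that case.\<close>

lemma finite_near_splittings: "finite (near_splittings \<gamma>)"
proof -
  let ?A = "{\<alpha>. set \<alpha> \<subseteq> {..sum_list \<gamma>} \<and> length \<alpha> \<le> sum_list \<gamma>}"
  have "near_splittings \<gamma> \<subseteq> ?A \<times> ?A"
  proof
    fix p assume "p \<in> near_splittings \<gamma>"
    then obtain \<alpha> \<beta> where p: "p = (\<alpha>, \<beta>)" and c: "\<alpha> \<in> compositions" "\<beta> \<in> compositions"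
      and "\<alpha> \<odot> \<beta> = \<gamma>" by (auto simp: near_splittings_def)
    then have s: "sum_list \<gamma> = sum_list \<alpha> + sum_list \<beta>"
      using sum_list_near_concat by metis
    then show "p \<in> ?A \<times> ?A"
      using length_le_sum_list[OF c(1)] length_le_sum_list[OF c(2)] p
      by (auto dest!: member_le_sum_list)
  qed
  then show ?thesis
    by (rule finite_subset) (intro finite_cartesian_product finite_lists_length_le finite_atMost)
qed

text \<open>A function on a group is represented by its extension by zero to the whole type.\<close>

definition class_functions :: "('a, 'b) monoid_scheme \<Rightarrow> ('a \<Rightarrow> complex) set" where
  "class_functions G = {\<phi>. (\<forall>x. x \<notin> carrier G \<longrightarrow> \<phi> x = 0) \<and>
     (\<forall>x\<in>carrier G. \<forall>y\<in>carrier G. \<phi> (x \<otimes>\<^bsub>G\<^esub> y \<otimes>\<^bsub>G\<^esub> inv\<^bsub>G\<^esub> x) = \<phi> y)}"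

text \<open>
  For finite groups \<open>G\<close> and \<open>H\<close> the tensor product of the spaces of class functions is identified
  with the space of class functions on \<open>G \<times>\<times> H\<close>, by means of the following elementary tensors.
  For the (commutative) groups used here this is justified below by the universal property.
\<close>

definition tensor :: "('a \<Rightarrow> complex) \<Rightarrow> ('b \<Rightarrow> complex) \<Rightarrow> 'a \<times> 'b \<Rightarrow> complex"
  (infixr "\<otimes>\<^sub>t" 70) where
  "\<phi> \<otimes>\<^sub>t \<psi> = (\<lambda>(x, y). \<phi> x * \<psi> y)"

definition lin_on :: "(complex \<Rightarrow> 'v \<Rightarrow> 'v) \<Rightarrow> ('a \<Rightarrow> complex) set \<Rightarrow>
    (('a \<Rightarrow> complex) \<Rightarrow> 'v::ab_group_add) \<Rightarrow> bool" where
  "lin_on scale V L \<longleftrightarrow>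
     (\<forall>f\<in>V. \<forall>g\<in>V. L (f + g) = L f + L g) \<and> (\<forall>c. \<forall>f\<in>V. L (\<lambda>x. c * f x) = scale c (L f))"

lemma class_functions_comm:
  assumes "comm_group G"
  shows "class_functions G = {\<phi>. \<forall>x. x \<notin> carrier G \<longrightarrow> \<phi> x = 0}"
proof -
  interpret comm_group G by fact
  have "x \<otimes>\<^bsub>G\<^esub> y \<otimes>\<^bsub>G\<^esub> inv\<^bsub>G\<^esub> x = y" if "x \<in> carrier G" "y \<in> carrier G" for x y
    using that by (simp add: m_comm[of x y] m_assoc)
  then show ?thesis by (auto simp: class_functions_def)
qed

lemma lin_on_sum:
  fixes scale :: "complex \<Rightarrow> 'v::ab_group_add \<Rightarrow> 'v"
  assumes "vector_space scale" "lin_on scale {\<phi>. \<forall>x. x \<notin> A \<longrightarrow> \<phi> x = 0} L"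
    and "finite I" and f: "\<And>i x. i \<in> I \<Longrightarrow> x \<notin> A \<Longrightarrow> f i x = 0"
  shows "L (\<lambda>x. \<Sum>i\<in>I. c i * f i x) = (\<Sum>i\<in>I. scale (c i) (L (f i)))"
  using \<open>finite I\<close> f
proof (induction I rule: finite_induct)
  case empty
  interpret vector_space scale by fact
  have "L (\<lambda>x. 0 * (0::complex)) = scale 0 (L (\<lambda>x. 0))"
    using assms(2) unfolding lin_on_def by (auto dest!: spec[of _ "0::complex"])
  then show ?case by (simp add: zero_fun_def)
next
  case (insert i I)
  have "(\<lambda>x. \<Sum>i\<in>insert i I. c i * f i x) = (\<lambda>x. c i * f i x) + (\<lambda>x. \<Sum>i\<in>I. c i * f i x)"
    using insert by (auto simp: fun_eq_iff)
  then have "L (\<lambda>x. \<Sum>i\<in>insert i I. c i * f i x) =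
      L (\<lambda>x. c i * f i x) + L (\<lambda>x. \<Sum>i\<in>I. c i * f i x)"
    using assms(2) insert.prems unfolding lin_on_def by (simp add: sum.neutral)
  also have "L (\<lambda>x. c i * f i x) = scale (c i) (L (f i))"
    using assms(2) insert.prems unfolding lin_on_def by simp
  finally show ?case using insert by simp
qed

theorem tensor_universal:
  fixes scale :: "complex \<Rightarrow> 'v::ab_group_add \<Rightarrow> 'v"
  assumes G: "comm_group G" "finite (carrier G)" and H: "comm_group H" "finite (carrier H)"
    and V: "vector_space scale"
    and b1: "\<And>\<psi>. \<psi> \<in> class_functions H \<Longrightarrow> lin_on scale (class_functions G) (\<lambda>\<phi>. b \<phi> \<psi>)"
    and b2: "\<And>\<phi>. \<phi> \<in> class_functions G \<Longrightarrow> lin_on scale (class_functions H) (\<lambda>\<psi>. b \<phi> \<psi>)"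
  shows "\<exists>L. lin_on scale (class_functions (G \<times>\<times> H)) L \<and>
      (\<forall>\<phi>\<in>class_functions G. \<forall>\<psi>\<in>class_functions H. L (\<phi> \<otimes>\<^sub>t \<psi>) = b \<phi> \<psi>) \<and>
      (\<forall>L'. lin_on scale (class_functions (G \<times>\<times> H)) L' \<and>
        (\<forall>\<phi>\<in>class_functions G. \<forall>\<psi>\<in>class_functions H. L' (\<phi> \<otimes>\<^sub>t \<psi>) = b \<phi> \<psi>) \<longrightarrow>
        (\<forall>f\<in>class_functions (G \<times>\<times> H). L' f = L f))"
proof -
  interpret vector_space scale by fact
  interpret G: comm_group G by fact
  interpret H: comm_group H by fact
  have GH: "comm_group (G \<times>\<times> H)"
    by (intro group.group_comm_groupI DirProd_group G.is_group H.is_group)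
       (auto simp: G.m_comm H.m_comm)
  note cf = class_functions_comm[OF G(1)] class_functions_comm[OF H(1)] class_functions_comm[OF GH]
  define d :: "'a \<Rightarrow> 'a \<Rightarrow> complex" where "d = (\<lambda>x z. if z = x then 1 else 0)"
  define e :: "'c \<Rightarrow> 'c \<Rightarrow> complex" where "e = (\<lambda>y z. if z = y then 1 else 0)"
  have d: "d x \<in> class_functions G" if "x \<in> carrier G" for x
    using that by (auto simp: cf d_def)
  have e: "e y \<in> class_functions H" if "y \<in> carrier H" for y
    using that by (auto simp: cf e_def)
  have dsum: "\<phi> = (\<lambda>z. \<Sum>x\<in>carrier G. \<phi> x * d x z)" if "\<phi> \<in> class_functions G" for \<phi>
    using that G(2) by (auto simp: cf d_def fun_eq_iff if_distrib[of "(*) _"] cong: if_cong)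
  have esum: "\<psi> = (\<lambda>z. \<Sum>y\<in>carrier H. \<psi> y * e y z)" if "\<psi> \<in> class_functions H" for \<psi>
    using that H(2) by (auto simp: cf e_def fun_eq_iff if_distrib[of "(*) _"] cong: if_cong)
  let ?I = "carrier G \<times> carrier H"
  have fin: "finite ?I" using G(2) H(2) by simp
  define L where "L f = (\<Sum>p\<in>?I. scale (f p) (b (d (fst p)) (e (snd p))))" for f
  have "lin_on scale (class_functions (G \<times>\<times> H)) L"
    by (simp add: lin_on_def L_def scale_left_distrib sum.distrib scale_sum_right)
  moreover have "L (\<phi> \<otimes>\<^sub>t \<psi>) = b \<phi> \<psi>" if \<phi>: "\<phi> \<in> class_functions G" and \<psi>: "\<psi> \<in> class_functions H" for \<phi> \<psi>
  proof -
    have "b \<phi> \<psi> = (\<Sum>x\<in>carrier G. scale (\<phi> x) (b (d x) \<psi>))"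
    proof -
      have "b (\<lambda>z. \<Sum>x\<in>carrier G. \<phi> x * d x z) \<psi> = (\<Sum>x\<in>carrier G. scale (\<phi> x) (b (d x) \<psi>))"
        using b1[OF \<psi>] d G(2) V by (intro lin_on_sum[where A = "carrier G"]) (auto simp: cf)
      then show ?thesis using dsum[OF \<phi>] by simp
    qed
    also have "\<dots> = (\<Sum>x\<in>carrier G. scale (\<phi> x) (\<Sum>y\<in>carrier H. scale (\<psi> y) (b (d x) (e y))))"
    proof (rule sum.cong[OF refl])
      fix x assume x: "x \<in> carrier G"
      have "b (d x) (\<lambda>z. \<Sum>y\<in>carrier H. \<psi> y * e y z) = (\<Sum>y\<in>carrier H. scale (\<psi> y) (b (d x) (e y)))"
        using b2[OF d[OF x]] e H(2) V by (intro lin_on_sum[where A = "carrier H"]) (auto simp: cf)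
      then show "scale (\<phi> x) (b (d x) \<psi>) = scale (\<phi> x) (\<Sum>y\<in>carrier H. scale (\<psi> y) (b (d x) (e y)))"
        using esum[OF \<psi>] by simp
    qed
    also have "\<dots> = L (\<phi> \<otimes>\<^sub>t \<psi>)"
      by (simp add: L_def tensor_def scale_sum_right sum.cartesian_product case_prod_unfold)
    finally show ?thesis ..
  qed
  moreover have "L' f = L f" if L': "lin_on scale (class_functions (G \<times>\<times> H)) L'"
      "\<forall>\<phi>\<in>class_functions G. \<forall>\<psi>\<in>class_functions H. L' (\<phi> \<otimes>\<^sub>t \<psi>) = b \<phi> \<psi>"
      and f: "f \<in> class_functions (G \<times>\<times> H)" for L' f
  proof -
    have "f = (\<lambda>q. \<Sum>p\<in>?I. f p * (d (fst p) \<otimes>\<^sub>t e (snd p)) q)"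
    proof
      fix q
      have "(d (fst p) \<otimes>\<^sub>t e (snd p)) q = (if p = q then 1 else 0)" for p
        by (auto simp: tensor_def d_def e_def split: prod.splits)
      then show "f q = (\<Sum>p\<in>?I. f p * (d (fst p) \<otimes>\<^sub>t e (snd p)) q)"
        using fin f by (cases q) (auto simp: cf if_distrib[of "(*) _"] cong: if_cong)
    qed
    moreover have "L' (\<lambda>q. \<Sum>p\<in>?I. f p * (d (fst p) \<otimes>\<^sub>t e (snd p)) q) =
        (\<Sum>p\<in>?I. scale (f p) (L' (d (fst p) \<otimes>\<^sub>t e (snd p))))"
      using L'(1) V fin
      by (intro lin_on_sum[where A = ?I]) (auto simp: cf tensor_def d_def e_def split: if_splits)
    ultimately show ?thesis
      using L'(2) d e by (auto simp: L_def intro!: sum.cong)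
  qed
  ultimately show ?thesis by blast
qed

text \<open>The group \<open>C\<close> is written multiplicatively, so \<open>\<one>\<^bsub>C\<^esub>\<close> stands for the zero element of \<open>C\<^sub>\<nu>\<close>.\<close>

definition Q :: "'a monoid \<Rightarrow> nat \<Rightarrow> (nat \<Rightarrow> 'a) monoid" where
  "Q C n = sum_group {1..n - 1} (\<lambda>_. C)"

definition kappa :: "'a monoid \<Rightarrow> nat \<Rightarrow> nat set \<Rightarrow> (nat \<Rightarrow> 'a) \<Rightarrow> complex" where
  "kappa C n S = indicator {g \<in> carrier (Q C n). \<forall>i\<in>{1..n - 1}. g i \<noteq> \<one>\<^bsub>C\<^esub> \<longleftrightarrow> i \<in> S}"

definition one_zero :: "'a monoid \<Rightarrow> (nat \<Rightarrow> 'a) \<Rightarrow> complex" where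
  "one_zero C = indicator (carrier (Q C 0))"

definition glue :: "'a monoid \<Rightarrow> nat \<Rightarrow> nat \<Rightarrow> (nat \<Rightarrow> 'a) \<Rightarrow> (nat \<Rightarrow> 'a) \<Rightarrow> nat \<Rightarrow> 'a" where
  "glue C n k x y =
     (\<lambda>i\<in>{1..n - 1}. if i < k then x i else if i = k then \<one>\<^bsub>C\<^esub> else y (i - k))"

definition coprod_component ::
  "'a monoid \<Rightarrow> nat \<Rightarrow> nat \<Rightarrow> ((nat \<Rightarrow> 'a) \<Rightarrow> complex) \<Rightarrow> (nat \<Rightarrow> 'a) \<times> (nat \<Rightarrow> 'a) \<Rightarrow> complex" where
  "coprod_component C n k \<phi> =
     (if k = 0 then one_zero C \<otimes>\<^sub>t \<phi>
      else if k = n then \<phi> \<otimes>\<^sub>t one_zero C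
      else (\<lambda>(x, y). if x \<in> carrier (Q C k) \<and> y \<in> carrier (Q C (n - k))
                     then \<phi> (glue C n k x y) else 0))"

text \<open>
  An element of the direct sum of the spaces \<open>cf(Q\<^sub>k) \<otimes> cf(Q\<^sub>m)\<close> is a finitely supported family
  indexed by the bidegree \<open>(k, m)\<close>. The bidegree must be recorded: \<open>Q\<^sub>0\<close> and \<open>Q\<^sub>1\<close> are the same
  trivial group, but \<open>cf(Q\<^sub>0)\<close> and \<open>cf(Q\<^sub>1)\<close> are different homogeneous components.
\<close>

type_synonym 'a cf_tensor =
  "nat \<times> nat \<Rightarrow>\<^sub>0 ((nat \<Rightarrow> 'a) \<times> (nat \<Rightarrow> 'a) \<Rightarrow> complex)"

definition coproduct :: "'a monoid \<Rightarrow> nat \<Rightarrow> ((nat \<Rightarrow> 'a) \<Rightarrow> complex) \<Rightarrow> 'a cf_tensor" where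
  "coproduct C n \<phi> = (\<Sum>k\<le>n. Poly_Mapping.single (k, n - k) (coprod_component C n k \<phi>))"

lemma Q_comm_group:
  assumes "comm_group C" shows "comm_group (Q C n)"
proof -
  interpret comm_group C by fact
  show ?thesis unfolding Q_def
    by (intro group.group_comm_groupI)
       (auto simp: carrier_sum_group PiE_iff m_comm intro!: restrict_ext)
qed

lemma carrier_Q:
  assumes "group C" shows "carrier (Q C n) = {1..n - 1} \<rightarrow>\<^sub>E carrier C"
  using assms by (auto simp: Q_def carrier_sum_group)

lemma finite_carrier_Q:
  assumes "group C" "finite (carrier C)" shows "finite (carrier (Q C n))"
  using assms by (simp add: carrier_Q finite_PiE)

lemma kappa_in_class_functions:
  assumes "comm_group C" shows "kappa C n S \<in> class_functions (Q C n)"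
  using class_functions_comm[OF Q_comm_group[OF assms]] by (auto simp: kappa_def)

lemma kappa_empty: "kappa C 0 (comp_set []) = one_zero C"
  by (auto simp: kappa_def one_zero_def comp_set_def)

lemma glue_in_carrier:
  assumes "group C" "1 \<le> k" "k < n" "x \<in> carrier (Q C k)" "y \<in> carrier (Q C (n - k))"
  shows "glue C n k x y \<in> carrier (Q C n)"
proof -
  interpret group C by fact
  have "i - k \<in> {1..n - k - 1}" if "i \<in> {1..n - 1}" "\<not> i < k" "i \<noteq> k" for i
    using that by auto
  then show ?thesis using assms by (auto simp: carrier_Q glue_def PiE_iff simp del: atLeastAtMost_iff) auto
qed

lemma coprod_component_in_tensor:
  assumes "comm_group C" "k \<le> n" "\<phi> \<in> class_functions (Q C n)"
  shows "coprod_component C n k \<phi> \<in> class_functions (Q C k \<times>\<times> Q C (n - k))"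
proof -
  have "comm_group (Q C k \<times>\<times> Q C (n - k))"
  proof -
    interpret A: comm_group "Q C k" by (rule Q_comm_group[OF assms(1)])
    interpret B: comm_group "Q C (n - k)" by (rule Q_comm_group[OF assms(1)])
    show ?thesis
      by (intro group.group_comm_groupI DirProd_group A.is_group B.is_group)
         (auto simp: A.m_comm B.m_comm)
  qed
  then show ?thesis
    using assms(2,3) class_functions_comm[OF Q_comm_group[OF assms(1)], of n]
    by (auto simp: class_functions_comm coprod_component_def tensor_def one_zero_def indicator_def)
qed

end

theory Submission
  imports Defs
begin

text \<open>
  Both sides are compared one bidegree \<open>(k, n - k)\<close> at a time. For \<open>0 < k < n\<close>, restricting
  \<open>\<kappa>\<^bsub>set(\<gamma>)\<^esub>\<close> to the tuples whose \<open>k\<close>-th coordinate is trivial gives zero when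
  \<open>k \<in> set(\<gamma>)\<close> (\<open>coprod_component_kappa_eq_0\<close>), because the indicator requires a nontrivial
  entry there. When \<open>k \<notin> set(\<gamma>)\<close> the condition on the remaining coordinates splits into one
  on the first \<open>k - 1\<close> and one on the last \<open>n - k - 1\<close>, so the restriction is a product of two
  indicators (\<open>kappa_glue\<close>), given by the parts of \<open>set(\<gamma>)\<close> below and above \<open>k\<close>.

  On the combinatorial side, the near-concatenation \<open>\<alpha> \<odot> \<beta>\<close> merges the last part of \<open>\<alpha>\<close> with
  the first part of \<open>\<beta>\<close>, so the point \<open>k = |\<alpha>|\<close> where the two compositions meet is not a partial
  sum of the result, and no other partial sum is lost (\<open>comp_set_near_concat\<close>). Hence
  \<open>\<gamma>\<close> can be split at \<open>k\<close> exactly when \<open>k \<notin> set(\<gamma>)\<close>, in one way only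
  (\<open>bij_betw_near_splittings\<close>), and the splitting at \<open>k\<close> contributes the product of indicators
  found in bidegree \<open>(k, n - k)\<close>. The components with \<open>k = 0\<close> and \<open>k = n\<close> match the splittings
  in which \<open>\<alpha>\<close> or \<open>\<beta>\<close> is empty.
\<close>

section \<open>Partial sums of a near-concatenation\<close>

lemma comp_set_simps [simp]:
  "comp_set [] = {}"
  "comp_set [a] = {}"
  by (auto simp: comp_set_def)

lemma comp_set_Cons_Cons [simp]:
  "comp_set (a # b # \<alpha>) = insert a ((+) a ` comp_set (b # \<alpha>))"
proof -
  have "comp_set (a # b # \<alpha>) = (\<lambda>j. sum_list (take j (a # b # \<alpha>))) ` {1..<Suc (Suc (length \<alpha>))}"
    by (auto simp: comp_set_def)
  also have "{1..<Suc (Suc (length \<alpha>))} = insert 1 (Suc ` {1..<Suc (length \<alpha>)})"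
    by auto
  also have "(\<lambda>j. sum_list (take j (a # b # \<alpha>))) ` \<dots> =
      insert a ((+) a ` (\<lambda>j. sum_list (take j (b # \<alpha>))) ` {1..<Suc (length \<alpha>)})"
    by (simp add: image_image del: image_Suc_atLeastLessThan)
  also have "(\<lambda>j. sum_list (take j (b # \<alpha>))) ` {1..<Suc (length \<alpha>)} = comp_set (b # \<alpha>)"
    by (auto simp: comp_set_def)
  finally show ?thesis .
qed

lemma compositions_Cons [simp]:
  "a # \<alpha> \<in> compositions \<longleftrightarrow> 0 < a \<and> \<alpha> \<in> compositions"
  by (auto simp: compositions_def)

lemma Nil_in_compositions [simp]: "[] \<in> compositions"
  by (simp add: compositions_def)

lemma comp_set_subset:
  "\<alpha> \<in> compositions \<Longrightarrow> comp_set \<alpha> \<subseteq> {0<..<sum_list \<alpha>}"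
  by (induction \<alpha> rule: induct_list012) auto

lemma sum_list_composition_eq_0_iff:
  "\<alpha> \<in> compositions \<Longrightarrow> sum_list \<alpha> = 0 \<longleftrightarrow> \<alpha> = []"
  by (cases \<alpha>) auto

lemma near_concat_Nil2 [simp]: "\<alpha> \<odot> [] = \<alpha>"
  by (cases \<alpha>) auto

lemma near_concat_single [simp]: "[a] \<odot> (b # \<beta>) = (a + b) # \<beta>"
  by simp

lemma near_concat_Cons_Cons [simp]:
  "\<beta> \<noteq> [] \<Longrightarrow> (a # a' # \<alpha>) \<odot> \<beta> = a # ((a' # \<alpha>) \<odot> \<beta>)"
  by (cases \<beta>) auto

lemma near_concat_Cons_nonempty:
  "\<exists>c \<gamma>. (a # \<alpha>) \<odot> \<beta> = c # \<gamma>"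
  by (cases \<beta>; cases \<alpha>) auto

declare near_concat.simps(3) [simp del]

text \<open>
  Merging the two parts at the junction removes exactly one partial sum of the plain
  concatenation: the junction \<open>sum_list \<alpha>\<close>, which neither set on the right contains when the
  parts are positive.
\<close>

lemma comp_set_near_concat:
  assumes "\<alpha> \<noteq> []" "\<beta> \<noteq> []"
  shows "comp_set (\<alpha> \<odot> \<beta>) = comp_set \<alpha> \<union> (+) (sum_list \<alpha>) ` comp_set \<beta>"
  using assms(1)
proof (induction \<alpha> rule: induct_list012)
  case (2 a)
  from assms(2) obtain b \<beta>' where [simp]: "\<beta> = b # \<beta>'" by (cases \<beta>) auto
  show ?case by (cases \<beta>') (auto simp: image_image add.assoc)
next
  case (3 a a' \<alpha>)
  obtain c \<gamma> where c: "(a' # \<alpha>) \<odot> \<beta> = c # \<gamma>"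
    using near_concat_Cons_nonempty by blast
  with 3 assms(2) show ?case
    by (auto simp: image_Un image_image add.assoc)
qed simp

text \<open>
  Every part of \<open>\<alpha>\<close> but the last is a part of \<open>\<alpha> \<odot> \<beta>\<close>, so common leading parts can be
  stripped until one left factor, say the first, is a single part \<open>a\<close>. If the other were
  \<open>c # c' # \<delta>\<close>, comparing first parts would give \<open>a + b = c\<close>, where \<open>b > 0\<close> is the first part
  of \<open>\<beta>\<close>, whereas equal sums of the left factors give \<open>a > c\<close>.
\<close>

lemma near_concat_cancel:
  assumes "\<alpha> \<in> compositions" "\<alpha>' \<in> compositions" "\<beta> \<in> compositions" "\<beta>' \<in> compositions"
    and "\<alpha> \<noteq> []" "\<alpha>' \<noteq> []" "\<beta> \<noteq> []" "\<beta>' \<noteq> []"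
    and "\<alpha> \<odot> \<beta> = \<alpha>' \<odot> \<beta>'" "sum_list \<alpha> = sum_list \<alpha>'"
  shows "\<alpha> = \<alpha>' \<and> \<beta> = \<beta>'"
proof -
  obtain b \<beta>1 b' \<beta>1' where \<beta>: "\<beta> = b # \<beta>1" "\<beta>' = b' # \<beta>1'"
    using assms(7,8) by (meson neq_Nil_conv)
  show ?thesis
    using assms(1,2,5,6,9,10)
  proof (induction \<alpha> arbitrary: \<alpha>' rule: induct_list012)
    case (2 a)
    then show ?case
      using assms(3,4) by (cases \<alpha>' rule: remdups_adj.cases) (auto simp: \<beta>)
  next
    case (3 a a1 \<alpha>)
    show ?case
    proof (cases \<alpha>' rule: remdups_adj.cases)
      case (3 c c1 \<delta>)
      then show ?thesis using "3.prems" "3.IH"(2)[of "c1 # \<delta>"] by (auto simp: \<beta>)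
    qed (use "3.prems" assms(3,4) in \<open>auto simp: \<beta>\<close>)
  qed simp
qed

section \<open>Splittings of a composition\<close>

text \<open>
  A point that is not a partial sum lies strictly inside some part; the two pieces of that part
  become the last part of \<open>\<alpha>\<close> and the first part of \<open>\<beta>\<close>.
\<close>

lemma near_splitting_exists:
  assumes "\<gamma> \<in> compositions" "0 < k" "k < sum_list \<gamma>" "k \<notin> comp_set \<gamma>"
  shows "\<exists>\<alpha> \<beta>. \<alpha> \<in> compositions \<and> \<beta> \<in> compositions \<and> \<alpha> \<noteq> [] \<and> \<beta> \<noteq> [] \<and>
    \<alpha> \<odot> \<beta> = \<gamma> \<and> sum_list \<alpha> = k"
  using assms
proof (induction \<gamma> arbitrary: k rule: induct_list012)
  case (2 c)
  then show ?case
    by (intro exI[of _ "[k]"] exI[of _ "[c - k]"]) auto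
next
  case (3 c d \<gamma>)
  show ?case
  proof (cases "k < c")
    case True
    with 3 show ?thesis
      by (intro exI[of _ "[k]"] exI[of _ "(c - k) # d # \<gamma>"]) auto
  next
    case False
    with 3 have "c < k" by auto
    moreover have "k - c \<notin> comp_set (d # \<gamma>)"
    proof
      assume "k - c \<in> comp_set (d # \<gamma>)"
      then have "c + (k - c) \<in> comp_set (c # d # \<gamma>)" by simp
      with \<open>c < k\<close> 3 show False by simp
    qed
    ultimately obtain \<alpha> \<beta> where "\<alpha> \<in> compositions" "\<beta> \<in> compositions" "\<alpha> \<noteq> []" "\<beta> \<noteq> []"
        "\<alpha> \<odot> \<beta> = d # \<gamma>" "sum_list \<alpha> = k - c"
      using "3.IH"(2)[of "k - c"] "3.prems" by fastforce
    then show ?thesis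
      using "3.prems" \<open>c < k\<close>
      by (intro exI[of _ "c # \<alpha>"] exI[of _ \<beta>]) (cases \<alpha>; auto)
  qed
qed simp

text \<open>
  The end points \<open>0\<close> and \<open>n\<close> are never in \<open>comp_set \<gamma>\<close>; they correspond to the splittings
  \<open>([], \<gamma>)\<close> and \<open>(\<gamma>, [])\<close>.
\<close>

lemma bij_betw_near_splittings:
  assumes "\<gamma> \<in> compositions_of n"
  shows "bij_betw (\<lambda>(\<alpha>, \<beta>). sum_list \<alpha>) (near_splittings \<gamma>) ({..n} - comp_set \<gamma>)"
proof -
  have \<gamma>: "\<gamma> \<in> compositions" "sum_list \<gamma> = n"
    using assms by (auto simp: compositions_of_def)
  have splitD: "\<alpha> \<in> compositions" "\<beta> \<in> compositions" "\<alpha> \<odot> \<beta> = \<gamma>" "sum_list \<alpha> + sum_list \<beta> = n"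
    if "(\<alpha>, \<beta>) \<in> near_splittings \<gamma>" for \<alpha> \<beta>
    using that \<gamma>(2) sum_list_near_concat[of \<alpha> \<beta>] by (auto simp: near_splittings_def)
  have inj: "\<alpha> = \<alpha>' \<and> \<beta> = \<beta>'"
    if s: "(\<alpha>, \<beta>) \<in> near_splittings \<gamma>" "(\<alpha>', \<beta>') \<in> near_splittings \<gamma>"
      and eq: "sum_list \<alpha> = sum_list \<alpha>'" for \<alpha> \<beta> \<alpha>' \<beta>'
  proof -
    note d = splitD[OF s(1)] splitD[OF s(2)]
    have "sum_list \<beta> = sum_list \<beta>'"
      using eq d(4,8) by linarith
    then have "\<alpha> = [] \<longleftrightarrow> \<alpha>' = []" "\<beta> = [] \<longleftrightarrow> \<beta>' = []"
      using eq d(1,2,5,6)[THEN sum_list_composition_eq_0_iff] by argo+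
    then consider "\<alpha> = []" "\<alpha>' = []" | "\<beta> = []" "\<beta>' = []"
      | "\<alpha> \<noteq> []" "\<alpha>' \<noteq> []" "\<beta> \<noteq> []" "\<beta>' \<noteq> []" by blast
    then show ?thesis
    proof cases
      case 3
      show ?thesis
        by (rule near_concat_cancel[OF d(1,5,2,6) 3]) (simp_all only: d(3,7) eq)
    qed (use d(3,7) in simp_all)
  qed
  have avoid: "sum_list \<alpha> \<notin> comp_set \<gamma>" if s: "(\<alpha>, \<beta>) \<in> near_splittings \<gamma>" for \<alpha> \<beta>
  proof (cases "\<alpha> = [] \<or> \<beta> = []")
    case True
    then show ?thesis
      using splitD[OF s] comp_set_subset[OF \<gamma>(1)] \<gamma>(2) by auto
  next
    case False
    then show ?thesis
      using splitD[OF s] comp_set_near_concat[of \<alpha> \<beta>]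
        comp_set_subset[of \<alpha>] comp_set_subset[of \<beta>] by auto
  qed
  have surj: "\<exists>\<alpha> \<beta>. (\<alpha>, \<beta>) \<in> near_splittings \<gamma> \<and> sum_list \<alpha> = k"
    if k: "k \<le> n" "k \<notin> comp_set \<gamma>" for k
  proof -
    consider "k = 0" | "k = n" | "0 < k" "k < n" using k(1) by linarith
    then show ?thesis
    proof cases
      case 1
      then show ?thesis
        using \<gamma> by (intro exI[of _ "[]"] exI[of _ \<gamma>]) (auto simp: near_splittings_def)
    next
      case 2
      then show ?thesis
        using \<gamma> by (intro exI[of _ \<gamma>] exI[of _ "[]"]) (auto simp: near_splittings_def)
    next
      case 3
      then show ?thesis
        using near_splitting_exists[OF \<gamma>(1), of k] k(2) \<gamma>(2) by (auto simp: near_splittings_def)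
    qed
  qed
  show ?thesis
    unfolding bij_betw_def
  proof (intro conjI equalityI subsetI)
    show "inj_on (\<lambda>(\<alpha>, \<beta>). sum_list \<alpha>) (near_splittings \<gamma>)"
      using inj by (auto simp: inj_on_def)
  next
    fix k assume "k \<in> (\<lambda>(\<alpha>, \<beta>). sum_list \<alpha>) ` near_splittings \<gamma>"
    then show "k \<in> {..n} - comp_set \<gamma>"
      using avoid splitD(4) by fastforce
  next
    fix k assume "k \<in> {..n} - comp_set \<gamma>"
    then show "k \<in> (\<lambda>(\<alpha>, \<beta>). sum_list \<alpha>) ` near_splittings \<gamma>"
      using surj[of k] by force
  qed
qed

section \<open>Homogeneous components of the coproduct\<close>

text \<open>
  The coordinates of a glued tuple other than the \<open>k\<close>-th are those of its two factors, and at
  \<open>k\<close> the entry is trivial while \<open>k\<close> lies in neither \<open>S\<close> nor the translate of \<open>T\<close>. So the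
  support condition decouples.
\<close>

lemma kappa_glue:
  assumes "group C" "0 < k" "0 < m" and S: "S \<subseteq> {0<..<k}" and T: "T \<subseteq> {0<..<m}"
    and x: "x \<in> carrier (Q C k)" and y: "y \<in> carrier (Q C m)"
  shows "kappa C (k + m) (S \<union> (+) k ` T) (glue C (k + m) k x y) = kappa C k S x * kappa C m T y"
proof -
  have glue: "glue C (k + m) k x y \<in> carrier (Q C (k + m))"
    using glue_in_carrier[of C k "k + m" x y] assms by simp
  have U: "i \<in> S \<union> (+) k ` T \<longleftrightarrow> (if i < k then i \<in> S else if i = k then False else i - k \<in> T)" for i
    using S T by (force simp: image_iff)
  have "(\<forall>i\<in>{1..k + m - 1}. glue C (k + m) k x y i \<noteq> \<one>\<^bsub>C\<^esub> \<longleftrightarrow> i \<in> S \<union> (+) k ` T) \<longleftrightarrow>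
      (\<forall>i\<in>{1..k - 1}. x i \<noteq> \<one>\<^bsub>C\<^esub> \<longleftrightarrow> i \<in> S) \<and> (\<forall>i\<in>{1..m - 1}. y i \<noteq> \<one>\<^bsub>C\<^esub> \<longleftrightarrow> i \<in> T)"
    (is "?L \<longleftrightarrow> ?X \<and> ?Y")
  proof (rule iffI; (rule conjI)?; rule ballI)
    fix i assume L: ?L and i: "i \<in> {1..k - 1}"
    have "i \<in> {1..k + m - 1}" "i < k" using i \<open>0 < k\<close> by auto
    then show "x i \<noteq> \<one>\<^bsub>C\<^esub> \<longleftrightarrow> i \<in> S"
      using L[rule_format, of i] by (simp add: glue_def U del: Un_iff)
  next
    fix i assume L: ?L and i: "i \<in> {1..m - 1}"
    have "k + i \<in> {1..k + m - 1}" "0 < i" using i \<open>0 < m\<close> by auto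
    then show "y i \<noteq> \<one>\<^bsub>C\<^esub> \<longleftrightarrow> i \<in> T"
      using L[rule_format, of "k + i"] by (simp add: glue_def U del: Un_iff)
  next
    fix i assume R: "?X \<and> ?Y" and i: "i \<in> {1..k + m - 1}"
    consider "i \<in> {1..k - 1}" "i < k" | "i = k" | "i - k \<in> {1..m - 1}" "k < i"
      using i by fastforce
    then show "glue C (k + m) k x y i \<noteq> \<one>\<^bsub>C\<^esub> \<longleftrightarrow> i \<in> S \<union> (+) k ` T"
      using R i by cases (auto simp: glue_def U simp del: Un_iff)
  qed
  then show ?thesis
    using glue x y by (simp add: kappa_def indicator_def)
qed

text \<open>
  If a factor is empty, its indicator is \<open>\<one>\<^sub>0\<close> and the claim is the convention for the two extreme
  components; otherwise the component is a restriction along \<open>glue\<close>.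
\<close>

lemma coprod_component_kappa_near_concat:
  assumes "group C" and \<alpha>: "\<alpha> \<in> compositions" and \<beta>: "\<beta> \<in> compositions"
    and n: "n = sum_list (\<alpha> \<odot> \<beta>)"
  shows "coprod_component C n (sum_list \<alpha>) (kappa C n (comp_set (\<alpha> \<odot> \<beta>))) =
    kappa C (sum_list \<alpha>) (comp_set \<alpha>) \<otimes>\<^sub>t kappa C (sum_list \<beta>) (comp_set \<beta>)"
proof -
  have n': "n = sum_list \<alpha> + sum_list \<beta>"
    using n by (simp add: sum_list_near_concat)
  consider "\<alpha> = []" | "\<alpha> \<noteq> []" "\<beta> = []" | "\<alpha> \<noteq> []" "\<beta> \<noteq> []" by blast
  then show ?thesis
  proof cases
    case 1
    with n' show ?thesis
      using kappa_empty[of C] by (simp add: coprod_component_def)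
  next
    case 2
    then have "sum_list \<alpha> \<noteq> 0"
      using \<alpha> sum_list_composition_eq_0_iff by blast
    with 2 n' show ?thesis
      using kappa_empty[of C] by (simp add: coprod_component_def del: sum_list_eq_0_iff)
  next
    case 3
    have pos: "0 < sum_list \<alpha>" "0 < sum_list \<beta>"
      using 3 \<alpha> \<beta> sum_list_composition_eq_0_iff by (metis gr0I)+
    have outside: "kappa C j S z = 0" if "z \<notin> carrier (Q C j)" for j S z
      using that by (simp add: kappa_def)
    show ?thesis
      using pos kappa_glue[OF \<open>group C\<close> pos comp_set_subset[OF \<alpha>] comp_set_subset[OF \<beta>]] outside
      by (auto simp: coprod_component_def tensor_def n' comp_set_near_concat[OF 3] fun_eq_iff
        simp del: sum_list_eq_0_iff)
  qed
qed

lemma coprod_component_kappa_eq_0: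
  assumes "k \<in> S" "0 < k" "k < n"
  shows "coprod_component C n k (kappa C n S) = 0"
proof -
  have "k \<in> {1..n - 1}" "glue C n k x y k = \<one>\<^bsub>C\<^esub>" for x y
    using assms by (auto simp: glue_def)
  then have "kappa C n S (glue C n k x y) = 0" for x y
    using assms(1) by (auto simp: kappa_def indicator_def)
  then show ?thesis
    using assms by (auto simp: coprod_component_def fun_eq_iff)
qed

section \<open>The coproduct formula\<close>

theorem proposition3p17:
  fixes C :: "'a monoid" and \<nu> n :: nat and \<gamma> :: "nat list"
  assumes "group C" and "cyclic_group C" and "order C = \<nu>" and "\<nu> > 1"
    and "\<gamma> \<in> compositions_of n"
  shows "coproduct C n (kappa C n (comp_set \<gamma>)) =
    (\<Sum>(\<alpha>, \<beta>)\<in>near_splittings \<gamma>.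
       Poly_Mapping.single (sum_list \<alpha>, sum_list \<beta>)
         (kappa C (sum_list \<alpha>) (comp_set \<alpha>) \<otimes>\<^sub>t kappa C (sum_list \<beta>) (comp_set \<beta>)))"
proof -
  have \<gamma>: "\<gamma> \<in> compositions" "sum_list \<gamma> = n"
    using assms(5) by (auto simp: compositions_of_def)
  define D where "D = (\<lambda>k. Poly_Mapping.single (k, n - k)
    (coprod_component C n k (kappa C n (comp_set \<gamma>))))"
  have "coproduct C n (kappa C n (comp_set \<gamma>)) = (\<Sum>k\<le>n. D k)"
    by (simp add: coproduct_def D_def)
  also have "\<dots> = (\<Sum>k\<in>{..n} - comp_set \<gamma>. D k)"
  proof (rule sum.mono_neutral_right)
    show "\<forall>k\<in>{..n} - ({..n} - comp_set \<gamma>). D k = 0"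
      using comp_set_subset[OF \<gamma>(1)] \<gamma>(2)
      by (auto simp: D_def subset_iff coprod_component_kappa_eq_0)
  qed auto
  also have "\<dots> = (\<Sum>p\<in>near_splittings \<gamma>. D (case p of (\<alpha>, \<beta>) \<Rightarrow> sum_list \<alpha>))"
    by (rule sum.reindex_bij_betw[OF bij_betw_near_splittings[OF assms(5)], symmetric])
  also have "\<dots> = (\<Sum>(\<alpha>, \<beta>)\<in>near_splittings \<gamma>.
       Poly_Mapping.single (sum_list \<alpha>, sum_list \<beta>)
         (kappa C (sum_list \<alpha>) (comp_set \<alpha>) \<otimes>\<^sub>t kappa C (sum_list \<beta>) (comp_set \<beta>)))"
  proof (rule sum.cong[OF refl], clarify)
    fix \<alpha> \<beta> assume "(\<alpha>, \<beta>) \<in> near_splittings \<gamma>"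
    then have s: "\<alpha> \<in> compositions" "\<beta> \<in> compositions" "\<gamma> = \<alpha> \<odot> \<beta>"
      by (auto simp: near_splittings_def)
    have "n - sum_list \<alpha> = sum_list \<beta>"
      using \<gamma>(2) by (simp add: s(3) sum_list_near_concat)
    then show "D (sum_list \<alpha>) = Poly_Mapping.single (sum_list \<alpha>, sum_list \<beta>)
         (kappa C (sum_list \<alpha>) (comp_set \<alpha>) \<otimes>\<^sub>t kappa C (sum_list \<beta>) (comp_set \<beta>))"
      using coprod_component_kappa_near_concat[OF assms(1) s(1,2)] \<gamma>(2) s(3) by (simp add: D_def)
  qed
  finally show ?thesis .
qed

end
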